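(* Let $t$ and $\ell \geq 2$ be integers, and let $m$ be a positive integer with $m \equiv -t \pmod{\ell}$ and $\gcd(m,\ell)=1$. Let $s$ be a non-negative integer such that $m > 2\ell s - t$. Then $$\sum_{n=s}^{\frac{(\ell-1)m-t}{\ell}+s} (-1)^n [2\ell n+t]\,\frac{(q^t;q^\ell)_{n+s}(q^t;q^\ell)_{n-s}(q^t;q^\ell)_{n}}{(q^\ell;q^\ell)_{n+s}(q^\ell;q^\ell)_{n-s}(q^\ell;q^\ell)_{n}}\Bigl\{q^{n\left(\frac{\ell}{2}(n+1)-t\right)}[t+\ell s][t-\ell s]+q^{(n-1)\left(\frac{\ell n}{2}-t\right)}[\ell n][t+\ell n]\Bigr\}\equiv 0 \pmod{[m]\,\Phi_m(q)^2}.$$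
   Context: Here $q$ is treated as an indeterminate. The $q$-shifted factorial is $(a;q)_0=1$ and $(a;q)_n=\prod_{k=0}^{n-1}(1-aq^k)$ for $n\ge 1$; thus $(q^t;q^\ell)_n=\prod_{k=0}^{n-1}(1-q^{t+\ell k})$. For an integer $r$ (possibly negative or zero), $[r]=[r]_q=\frac{1-q^r}{1-q}$. $\Phi_m(q)$ is the $m$-th cyclotomic polynomial. For a rational function $A(q)\in\mathbb{Q}(q)$ and a polynomial $P(q)\in\mathbb{Z}[q]$, $A(q)\equiv 0\pmod{P(q)}$ means that, writing $A$ as a quotient of coprime polynomials in $q$, the numerator is divisible by $P(q)$ in $\mathbb{Q}[q]$. The upper summation limit is an integer because $m\equiv -t\pmod\ell$; a sum whose upper limit is less than its lower limit is $0$.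
   Formalization: The case m = 1, s = 0, t = ℓ − 1 is excluded: there the sum is the single term [ℓ−1]^3, whose value at q = 1 is (ℓ−1)^3 ≠ 0, so it is not divisible by [1]Φ_1(q)^2 = (q−1)^2 and the claim fails. *)

theory Defs
  imports
    "HOL-Computational_Algebra.Computational_Algebra"
    "HOL-Number_Theory.Cong"
begin

definition qvar :: "rat poly fract" where
  "qvar = to_fract [:0, 1:]"

definition qint :: "int \<Rightarrow> rat poly fract" where
  "qint r = (1 - qvar powi r) / (1 - qvar)"

definition qpoch :: "'a::comm_ring_1 \<Rightarrow> 'a \<Rightarrow> nat \<Rightarrow> 'a" where
  "qpoch a b n = (\<Prod>k<n. 1 - a * b ^ k)"

definition qint_poly :: "nat \<Rightarrow> rat poly" where
  "qint_poly m = (\<Sum>k<m. monom 1 k)"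

definition primitive_unity_roots :: "nat \<Rightarrow> complex set" where
  "primitive_unity_roots n = {z. z ^ n = 1 \<and> (\<forall>k. 0 < k \<and> k < n \<longrightarrow> z ^ k \<noteq> 1)}"

(* The description is well defined by lemma map_poly_cyclotomic below.
   In particular the first cyclotomic polynomial is X - 1. *)
definition cyclotomic :: "nat \<Rightarrow> rat poly" where
  "cyclotomic n =
     (THE p. map_poly of_rat p = (\<Prod>z\<in>primitive_unity_roots n. [:- z, 1:]))"

(* By coprimality the pair (a, b) is unique up to a constant factor, so it does not
   matter that it is quantified existentially. *)
definition ratfun_cong_0 :: "rat poly fract \<Rightarrow> rat poly \<Rightarrow> bool" where
  "ratfun_cong_0 A P \<longleftrightarrow>
     (\<exists>a b. b \<noteq> 0 \<and> coprime a b \<and> A = to_fract a / to_fract b \<and> P dvd a)"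


lemma qvar_power: "qvar ^ n = to_fract (monom 1 n)"
proof -
  have "to_fract ([:0, 1:] ^ n :: rat poly) = qvar ^ n"
  proof (induction n)
    case (Suc n)
    thus ?case by (simp only: power_Suc to_fract_mult qvar_def)
  qed simp
  thus ?thesis by (simp add: monom_altdef)
qed

lemma qvar_nz: "qvar \<noteq> 0" and qvar_neq_1: "qvar \<noteq> 1"
proof -
  have "(to_fract [:0, 1:] = (to_fract 0 :: rat poly fract)) = False"
    by (simp only: to_fract_eq_iff) simp
  thus "qvar \<noteq> 0" by (simp add: qvar_def)
  have "(to_fract [:0, 1:] = (to_fract 1 :: rat poly fract)) = False"
    by (simp only: to_fract_eq_iff) (simp add: one_pCons)
  thus "qvar \<noteq> 1" by (simp add: qvar_def)
qed

lemma to_fract_qint_poly: "to_fract (qint_poly m) = qint (int m)"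
proof -
  have "to_fract (qint_poly m) = (\<Sum>k<m. qvar ^ k)"
    unfolding qint_poly_def by (induction m) (simp_all add: qvar_power)
  also have "\<dots> = (1 - qvar ^ m) / (1 - qvar)"
    using qvar_neq_1 by (simp add: sum_gp_strict)
  finally show ?thesis by (simp add: qint_def)
qed

lemma map_poly_of_rat_mult:
  "map_poly of_rat (p * q) = (map_poly of_rat p * map_poly of_rat q :: 'a::field_char_0 poly)"
  by (intro poly_eqI) (simp add: coeff_map_poly coeff_mult of_rat_sum of_rat_mult)

lemma map_poly_of_rat_add:
  "map_poly of_rat (p + q) = (map_poly of_rat p + map_poly of_rat q :: 'a::field_char_0 poly)"
  by (intro poly_eqI) (simp add: coeff_map_poly of_rat_add)

lemma map_poly_of_rat_diff:
  "map_poly of_rat (p - q) = (map_poly of_rat p - map_poly of_rat q :: 'a::field_char_0 poly)"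
  by (intro poly_eqI) (simp add: coeff_map_poly of_rat_diff)

lemma map_poly_of_rat_prod:
  "map_poly of_rat (prod f A) = (\<Prod>x\<in>A. map_poly of_rat (f x) :: 'a::field_char_0 poly)"
  by (induction A rule: infinite_finite_induct) (simp_all add: map_poly_of_rat_mult)

lemma inj_map_poly_of_rat: "inj (map_poly of_rat :: rat poly \<Rightarrow> 'a::field_char_0 poly)"
proof (rule injI)
  fix p q :: "rat poly"
  assume "map_poly of_rat p = (map_poly of_rat q :: 'a poly)"
  hence "coeff (map_poly of_rat p) n = coeff (map_poly of_rat q :: 'a poly) n" for n
    by simp
  thus "p = q" by (intro poly_eqI) (simp add: coeff_map_poly)
qed

lemma finite_primitive_unity_roots: "n > 0 \<Longrightarrow> finite (primitive_unity_roots n)"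
  by (rule finite_subset[OF _ finite_roots_unity[of n]]) (auto simp: primitive_unity_roots_def)

lemma unity_root_primitive_order:
  fixes z :: complex
  assumes "n > 0" "z ^ n = 1"
  shows "\<exists>!d. d dvd n \<and> z \<in> primitive_unity_roots d"
proof -
  define d where "d = (LEAST k. k > 0 \<and> z ^ k = 1)"
  have d: "d > 0 \<and> z ^ d = 1"
    unfolding d_def by (rule LeastI[of _ n]) (use assms in auto)
  have least: "d \<le> k" if "k > 0" "z ^ k = 1" for k
    unfolding d_def by (rule Least_le) (use that in auto)
  have "z ^ n = z ^ (d * (n div d) + n mod d)" by simp
  also have "\<dots> = z ^ (n mod d)" using d by (simp only: power_add power_mult) simp
  finally have "z ^ (n mod d) = 1" using assms by simp
  hence "n mod d = 0" using least[of "n mod d"] d mod_less_divisor[of d n] by fastforce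
  hence "d dvd n" by auto
  moreover have "z \<in> primitive_unity_roots d"
    unfolding primitive_unity_roots_def
  proof (intro CollectI conjI allI impI)
    fix k assume "0 < k \<and> k < d"
    thus "z ^ k \<noteq> 1" using least[of k] by linarith
  qed (use d in simp)
  moreover have "e = d" if "e dvd n" "z \<in> primitive_unity_roots e" for e
  proof -
    have e: "e > 0" using that(1) \<open>n > 0\<close> by (rule dvd_pos_nat[rotated])
    have "z ^ e = 1" and "\<not> d < e"
      using that(2) d unfolding primitive_unity_roots_def by blast+
    with least[OF e] show "e = d" by simp
  qed
  ultimately show ?thesis by blast
qed

lemma prod_unity_roots:
  assumes "n > 0"
  shows "(\<Prod>z | z ^ n = (1::complex). [:- z, 1:]) = monom 1 n - 1"
proof -
  define p :: "complex poly" where "p = monom 1 n - 1"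
  have poly_p: "poly p z = z ^ n - 1" for z by (simp add: p_def poly_monom)
  have "pderiv p = monom (of_nat n) (n - 1)"
    by (simp add: p_def pderiv_diff pderiv_monom)
  hence deriv: "poly (pderiv p) z = of_nat n * z ^ (n - 1)" for z by (simp add: poly_monom)
  have "rsquarefree p"
    unfolding rsquarefree_roots
  proof safe
    fix z assume z: "poly p z = 0" "poly (pderiv p) z = 0"
    hence "z = 0" using assms by (auto simp: deriv)
    thus False using z assms by (simp add: poly_p zero_power)
  qed
  hence "smult (lead_coeff p) (\<Prod>z | poly p z = 0. [:- z, 1:]) = p"
    by (rule complex_poly_decompose_rsquarefree)
  moreover have "lead_coeff p = 1"
  proof -
    have "coeff p n = 1" using assms by (simp add: p_def)
    moreover have "degree p \<le> n" unfolding p_def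
      by (intro degree_diff_le degree_monom_le) auto
    moreover have "n \<le> degree p" using \<open>coeff p n = 1\<close> by (intro le_degree) simp
    ultimately show ?thesis by simp
  qed
  ultimately show ?thesis by (simp add: poly_p p_def[symmetric])
qed

lemma prod_primitive_unity_roots:
  assumes "n > 0"
  shows "(\<Prod>d | d dvd n. \<Prod>z\<in>primitive_unity_roots d. [:- z, 1:]) = monom 1 n - 1"
proof -
  have pos: "d > 0" if "d dvd n" for d using that assms by (auto intro: Nat.gr0I)
  have un: "{z. z ^ n = 1} = (\<Union>d\<in>{d. d dvd n}. primitive_unity_roots d)"
  proof (intro equalityI subsetI)
    fix z :: complex assume "z \<in> {z. z ^ n = 1}"
    thus "z \<in> (\<Union>d\<in>{d. d dvd n}. primitive_unity_roots d)"
      using unity_root_primitive_order[OF assms, of z] by blast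
  next
    fix z assume "z \<in> (\<Union>d\<in>{d. d dvd n}. primitive_unity_roots d)"
    then obtain d k where "n = d * k" "z ^ d = 1"
      by (auto simp: primitive_unity_roots_def)
    thus "z \<in> {z. z ^ n = 1}" by (simp add: power_mult)
  qed
  have "(\<Prod>z | z ^ n = (1::complex). [:- z, 1:]) =
        (\<Prod>d | d dvd n. \<Prod>z\<in>primitive_unity_roots d. [:- z, 1:])"
    unfolding un
  proof (rule prod.UNION_disjoint)
    show "finite {d. d dvd n}" using assms by simp
    show "\<forall>d\<in>{d. d dvd n}. finite (primitive_unity_roots d)"
      using pos finite_primitive_unity_roots by auto
    show "\<forall>d\<in>{d. d dvd n}. \<forall>e\<in>{d. d dvd n}. d \<noteq> e \<longrightarrow>
            primitive_unity_roots d \<inter> primitive_unity_roots e = {}"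
    proof safe
      fix d e z
      assume *: "d dvd n" "e dvd n" "d \<noteq> e"
        "z \<in> primitive_unity_roots d" "z \<in> primitive_unity_roots e"
      have "z \<in> {z. z ^ n = 1}" using * unfolding un by blast
      hence "z ^ n = 1" by simp
      from unity_root_primitive_order[OF assms this] * show "z \<in> {}" by blast
    qed
  qed
  thus ?thesis using prod_unity_roots[OF assms] by simp
qed

lemma map_poly_of_rat_cofactor:
  fixes g h :: "complex poly"
  assumes eq: "map_poly of_rat p = map_poly of_rat r * h" and r: "r \<noteq> 0"
  shows "\<exists>s. map_poly of_rat s = h"
proof -
  define s t where "s = p div r" and "t = p mod r"
  let ?m = "map_poly of_rat :: rat poly \<Rightarrow> complex poly"
  have deg: "degree (?m x) = degree x" for x
    by (rule degree_map_poly) simp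
  have "?m p = ?m r * ?m s + ?m t"
    unfolding s_def t_def by (simp flip: map_poly_of_rat_mult map_poly_of_rat_add)
  hence t: "?m t = ?m r * (h - ?m s)" using eq by (simp add: algebra_simps)
  have r': "?m r \<noteq> 0" using r inj_map_poly_of_rat[where 'a = complex]
    by (metis injD map_poly_0)
  have "h - ?m s = 0"
  proof (rule ccontr)
    assume ne: "h - ?m s \<noteq> 0"
    hence "?m t \<noteq> 0" using t r' by simp
    hence "t \<noteq> 0" by auto
    hence "degree t < degree r" using r degree_mod_less[of r p] by (simp add: t_def)
    moreover have "degree (?m t) = degree (?m r) + degree (h - ?m s)"
      using t r' ne by (simp add: degree_mult_eq)
    ultimately show False by (simp add: deg)
  qed
  thus ?thesis by (intro exI[of _ s]) simp
qed

lemma map_poly_cyclotomic: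
  assumes "n > 0"
  shows "map_poly of_rat (cyclotomic n) = (\<Prod>z\<in>primitive_unity_roots n. [:- z, 1:])"
proof -
  define C where "C n = (\<Prod>z\<in>primitive_unity_roots n. [:- z, 1:])" for n
  have "\<exists>p. map_poly of_rat p = C n" using assms
  proof (induction n rule: less_induct)
    case (less n)
    define D where "D = {d. d dvd n \<and> d \<noteq> n}"
    have fin: "finite {d. d dvd n}" using less.prems by simp
    have D: "{d. d dvd n} = insert n D" "n \<notin> D" "finite D"
      using fin by (auto simp: D_def intro: finite_subset[OF _ fin])
    have "\<exists>p. map_poly of_rat p = C d" if "d \<in> D" for d
      using that less.prems by (intro less.IH) (auto simp: D_def intro: Nat.gr0I dest: dvd_imp_le)
    then obtain f where f: "\<And>d. d \<in> D \<Longrightarrow> map_poly of_rat (f d) = C d" by metis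
    have "map_poly of_rat (prod f D) = prod C D"
      by (simp add: map_poly_of_rat_prod f)
    moreover have "prod C D * C n = monom 1 n - 1"
      using prod_primitive_unity_roots[OF less.prems] D by (simp add: C_def mult.commute)
    moreover have "map_poly of_rat (monom 1 n - 1) = (monom 1 n - 1 :: complex poly)"
      by (simp add: map_poly_of_rat_diff map_poly_monom)
    ultimately have "map_poly of_rat (monom 1 n - 1) = map_poly of_rat (prod f D) * C n"
      by simp
    moreover have "prod f D \<noteq> 0"
    proof
      assume "prod f D = 0"
      with \<open>map_poly of_rat (prod f D) = prod C D\<close> have "prod C D = 0" by simp
      then obtain d where "d \<in> D" "C d = 0" using D(3) by auto
      moreover have "finite (primitive_unity_roots d)"
        using \<open>d \<in> D\<close> less.prems
        by (intro finite_primitive_unity_roots) (auto simp: D_def intro: Nat.gr0I)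
      ultimately show False by (auto simp: C_def)
    qed
    ultimately show ?case by (rule map_poly_of_rat_cofactor)
  qed
  then obtain p where p: "map_poly of_rat p = C n" by blast
  have "map_poly of_rat (cyclotomic n) = C n"
    unfolding cyclotomic_def C_def[symmetric]
  proof (rule theI[of _ p])
    fix q :: "rat poly" assume "map_poly of_rat q = C n"
    with p show "q = p" by (intro injD[OF inj_map_poly_of_rat[where 'a = complex]]) simp
  qed (rule p)
  thus ?thesis by (simp add: C_def)
qed

lemma prod_cyclotomic:
  assumes "n > 0"
  shows "(\<Prod>d | d dvd n. cyclotomic d) = monom 1 n - 1"
proof -
  have "map_poly of_rat (\<Prod>d | d dvd n. cyclotomic d) =
        (\<Prod>d | d dvd n. \<Prod>z\<in>primitive_unity_roots d. [:- z, 1:])"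
    unfolding map_poly_of_rat_prod
    by (intro prod.cong map_poly_cyclotomic) (use assms in \<open>auto intro: Nat.gr0I\<close>)
  also have "\<dots> = map_poly of_rat (monom 1 n - 1)"
    using prod_primitive_unity_roots[OF assms]
    by (simp add: map_poly_of_rat_diff map_poly_monom)
  finally show ?thesis using inj_map_poly_of_rat by (auto dest: injD)
qed

end

theory Submission
  imports Defs "HOL-Computational_Algebra.Field_as_Ring"
begin

text \<open>With \<open>a = q ^ t\<close> and \<open>p = q ^ l\<close>, the combination in braces is exactly what makes the
  very-well-poised sum telescope: the sum up to \<open>N\<close> is a monomial times
  \<open>(1 - q)\<^sup>-\<^sup>3 R (N + s) R (N - s) R N\<close> with \<open>R K = (a; p)\<^sub>K\<^sub>+\<^sub>1 / (p; p)\<^sub>K\<close>.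
  For the given upper limit \<open>N\<close>, the last factor \<open>1 - q ^ ((l - 1) * m)\<close> of
  \<open>(a; p)\<^sub>K\<^sub>+\<^sub>1\<close> at \<open>K = N - s\<close> occurs in all three numerators. Let \<open>g\<close> be a prime polynomial
  dividing \<open>[m]\<close> and \<open>d\<close> the order of \<open>q\<close> modulo \<open>g\<close>; as \<open>d\<close> is coprime to \<open>l\<close>, the polynomial
  \<open>g\<close> divides every \<open>d\<close>-th factor of each shifted factorial, and exactly once in the denominators.
  Counting factors, \<open>R (N - s)\<close> always contains \<open>g\<close> and the other two are \<open>g\<close>-integral. If \<open>d = m\<close>,
  the condition on \<open>m\<close> keeps \<open>g\<close> out of all denominators, so all three quotients contain \<open>g\<close>.\<close>

section \<open>Telescoping of the very-well-poised sum\<close>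

lemma qpoch_Suc: "qpoch a b (Suc n) = qpoch a b n * (1 - a * b ^ n)"
  by (simp add: qpoch_def)

text \<open>Each summand splits as \<open>?S n + G n\<close> with \<open>G (Suc n) = - ?S n\<close>
  and \<open>G s = 0\<close>, so only \<open>?S N\<close> survives. The recurrence determines
  \<open>w\<close> up to a constant factor, as \<open>(-1)^n p^(n(n+1)/2) / a^n\<close>, without
  halving an exponent.\<close>

lemma well_poised_sum_telescopes:
  fixes a p :: "'a::field"
  assumes "a \<noteq> 0" "p \<noteq> 0" and p: "\<And>k. k > 0 \<Longrightarrow> p ^ k \<noteq> 1"
    and w: "\<And>n. w (Suc n) * a = - w n * p ^ Suc n"
    and "s \<le> N"
  shows "(\<Sum>n=s..N. w n * (1 - a * p ^ (2 * n))
      * ((qpoch a p (n + s) * qpoch a p (n - s) * qpoch a p n)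
         / (qpoch p p (n + s) * qpoch p p (n - s) * qpoch p p n))
      * ((1 - a * p ^ s) * (1 - a / p ^ s) + a / p ^ n * (1 - p ^ n) * (1 - a * p ^ n)))
    = w N * (qpoch a p (Suc (N + s)) / qpoch p p (N + s))
          * (qpoch a p (Suc (N - s)) / qpoch p p (N - s))
          * (qpoch a p (Suc N) / qpoch p p N)"
    (is "sum ?F _ = ?S N")
proof -
  define W where "W n = w n * ((qpoch a p (n + s) * qpoch a p (n - s) * qpoch a p n)
         / (qpoch p p (n + s) * qpoch p p (n - s) * qpoch p p n))" for n
  define G where
    "G n = W n * (a / p ^ n * (1 - p ^ n * p ^ s) * (1 - p ^ n / p ^ s) * (1 - p ^ n))" for n
  have nz: "p ^ k \<noteq> 0" for k
    using \<open>p \<noteq> 0\<close> by simp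
  have qp: "qpoch p p k \<noteq> 0" for k
    using p[of "Suc i" for i] by (simp add: qpoch_def)
  have S: "?S n = W n * ((1 - a * p ^ n * p ^ s) * (1 - a * p ^ n / p ^ s) * (1 - a * p ^ n))"
    if "s \<le> n" for n
    using that by (simp add: W_def qpoch_Suc power_add power_diff[OF \<open>p \<noteq> 0\<close>])
  have F: "?F n = ?S n + G n" if "s \<le> n" for n
  proof -
    \<comment> \<open>Here \<open>u = p ^ n\<close> and \<open>z = p ^ s\<close>. The first product
      on the right extends the three numerators of \<open>W n\<close> by one factor each; the second
      cancels the last factors of its denominators.\<close>
    have "(1 - a * u ^ 2) * ((1 - a * z) * (1 - a / z) + a / u * (1 - u) * (1 - a * u))
        = (1 - a * u * z) * (1 - a * u / z) * (1 - a * u)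
          + a / u * (1 - u * z) * (1 - u / z) * (1 - u)"
      if "u \<noteq> 0" "z \<noteq> 0" for u z
      using that by (simp add: field_simps power2_eq_square)
    from this[OF nz nz, of n s] show ?thesis
      unfolding S[OF that] G_def distrib_left[symmetric]
      by (simp add: W_def power_mult mult_ac)
  qed
  have G: "G (Suc n) = - ?S n" if "s \<le> n" for n
  proof -
    have pk: "1 - p ^ Suc k \<noteq> 0" for k
      using p[of "Suc k"] by simp
    have "w (Suc n) = - w n * p ^ Suc n / a"
      using w[of n] \<open>a \<noteq> 0\<close> by (simp add: field_simps)
    moreover have "qpoch p p (Suc k) = qpoch p p k * (1 - p ^ Suc k)" for k
      by (simp add: qpoch_Suc)
    moreover have "p ^ Suc n * p ^ s = p ^ Suc (n + s)" "p ^ Suc n / p ^ s = p ^ Suc (n - s)"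
      using that by (simp_all add: power_add power_diff[OF \<open>p \<noteq> 0\<close>])
    ultimately show ?thesis
      using that \<open>a \<noteq> 0\<close> nz[of "Suc n"] pk[of n] pk[of "n + s"] pk[of "n - s"]
      unfolding G_def W_def by (simp add: Suc_diff_le mult.assoc del: power_Suc)
  qed
  show ?thesis
    using \<open>s \<le> N\<close>
  proof (induction rule: dec_induct)
    case base
    \<comment> \<open>The factor \<open>1 - p ^ n / p ^ s\<close> vanishes at
      \<open>n = s\<close>.\<close>
    have "G s = 0"
      using nz by (simp add: G_def)
    then show ?case
      using F[of s] by simp
  next
    case (step n)
    then show ?case
      using F[of "Suc n"] G[of n] by simp
  qed
qed

subsection \<open>Orders of vanishing of rational functions\<close>

text \<open>For prime \<open>p\<close>, a lower bound on the \<open>p\<close>-adic valuation;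
  negative \<open>e\<close> allows poles. Since \<open>x\<close> may be 0, zero satisfies every
  bound and needs no infinite order.\<close>

definition ord_ge :: "'a::idom \<Rightarrow> int \<Rightarrow> 'a fract \<Rightarrow> bool" where
  "ord_ge p e A \<longleftrightarrow> (\<exists>x y. \<not> p dvd y \<and> A = to_fract p powi e * (to_fract x / to_fract y))"

lemma to_fract_power: "to_fract (x ^ n) = to_fract x ^ n"
  by (induction n) simp_all

lemma ord_ge_to_fract: "\<not> p dvd 1 \<Longrightarrow> ord_ge p (int e) (to_fract (p ^ e * x))"
  unfolding ord_ge_def by (intro exI[of _ x] exI[of _ 1]) (simp add: to_fract_power)

lemma ord_ge_mult:
  assumes "prime_elem p" "ord_ge p e A" "ord_ge p f B"
  shows "ord_ge p (e + f) (A * B)"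
proof -
  obtain x y x' y' where *: "\<not> p dvd y" "A = to_fract p powi e * (to_fract x / to_fract y)"
    "\<not> p dvd y'" "B = to_fract p powi f * (to_fract x' / to_fract y')"
    using assms unfolding ord_ge_def by blast
  have "p \<noteq> 0"
    using assms(1) by auto
  then show ?thesis
    unfolding ord_ge_def
    using * assms(1) by (intro exI[of _ "x * x'"] exI[of _ "y * y'"])
      (auto simp: power_int_add prime_elem_dvd_mult_iff)
qed

lemma ord_ge_prod:
  assumes "prime_elem p" "\<And>i. i \<in> I \<Longrightarrow> ord_ge p (e i) (f i)"
  shows "ord_ge p (sum e I) (prod f I)"
  using assms(2)
proof (induction I rule: infinite_finite_induct)
  case (insert i I)
  then show ?case
    by (simp add: ord_ge_mult[OF assms(1)])
qed (use assms(1) ord_ge_to_fract[of p 0 1] in \<open>auto simp: prime_elem_def\<close>)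

lemma ord_ge_power_0:
  assumes "prime_elem p" "ord_ge p 0 A"
  shows "ord_ge p 0 (A ^ n)"
  using ord_ge_prod[OF assms(1), of "{..<n}" "\<lambda>_. 0" "\<lambda>_. A"] assms(2) by simp

lemma ord_ge_mono:
  assumes "p \<noteq> 0" "ord_ge p e A" "f \<le> e"
  shows "ord_ge p f A"
proof -
  obtain x y where *: "\<not> p dvd y" "A = to_fract p powi e * (to_fract x / to_fract y)"
    using assms unfolding ord_ge_def by blast
  have "to_fract p powi e = to_fract p powi (f + int (nat (e - f)))"
    using assms by simp
  also have "\<dots> = to_fract p powi f * to_fract (p ^ nat (e - f))"
    using assms(1) by (simp only: power_int_add power_int_of_nat to_fract_power to_fract_eq_0_iff not_False_eq_True simp_thms)
  finally show ?thesis
    unfolding ord_ge_def using *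
    by (intro exI[of _ "p ^ nat (e - f) * x"] exI[of _ y]) simp
qed

text \<open>Clearing denominators gives \<open>a * y = p ^ e * (x * b)\<close> with \<open>y\<close>
  prime to \<open>p\<close>. Hence \<open>a\<close> and \<open>b\<close> need not be
  coprime.\<close>

lemma power_dvd_if_ord_ge:
  fixes p :: "'a::factorial_ring_gcd"
  assumes "prime_elem p" "ord_ge p (int e) (to_fract a / to_fract b)" "b \<noteq> 0"
  shows "p ^ e dvd a"
proof -
  obtain x y where *: "\<not> p dvd y"
      "to_fract a / to_fract b = to_fract p powi int e * (to_fract x / to_fract y)"
    using assms unfolding ord_ge_def by blast
  have "y \<noteq> 0"
    using * by auto
  with * \<open>b \<noteq> 0\<close> have "to_fract (a * y) = to_fract (p ^ e * x * b)"
    by (simp add: field_simps to_fract_power)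
  then have "a * y = p ^ e * (x * b)"
    unfolding to_fract_eq_iff by (simp add: mult.assoc)
  then have "p ^ e dvd a * y"
    by simp
  moreover have "coprime (p ^ e) y"
    using assms(1) *(1) by (simp add: prime_elem_imp_coprime)
  ultimately show ?thesis
    by (simp add: coprime_dvd_mult_left_iff)
qed

text \<open>Divisibility of the reduced numerator by \<open>P\<close> can be tested one prime at a
  time.\<close>

lemma ratfun_cong_0I:
  assumes "P \<noteq> 0"
    and "\<And>p. prime_elem p \<Longrightarrow> p dvd P \<Longrightarrow> ord_ge p (int (multiplicity p P)) A"
  shows "ratfun_cong_0 A P"
proof -
  obtain a b where ab: "quot_of_fract A = (a, b)"
    by fastforce
  have b: "b \<noteq> 0"
    using snd_quot_of_fract_nonzero[of A] ab by simp
  have A: "A = to_fract a / to_fract b"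
    using Fract_quot_of_fract[of A] ab by (simp add: Fract_conv_to_fract)
  have "coprime a b"
    using coprime_quot_of_fract[of A] ab by simp
  moreover have "P dvd a"
  proof (cases "a = 0")
    case False
    show ?thesis
    proof (rule multiplicity_le_imp_dvd[OF \<open>P \<noteq> 0\<close>])
      fix p :: "rat poly" assume p: "prime p"
      show "multiplicity p P \<le> multiplicity p a"
      proof (cases "p dvd P")
        case True
        then have "p ^ multiplicity p P dvd a"
          using p assms(2)[of p] b by (intro power_dvd_if_ord_ge[of p _ a b]) (auto simp: A)
        then show ?thesis
          using p False by (intro multiplicity_geI) auto
      qed (simp add: not_dvd_imp_multiplicity_0)
    qed
  qed simp
  ultimately show ?thesis
    using A b unfolding ratfun_cong_0_def by blast
qed

subsection \<open>Prime factors of \<open>X ^ m - 1\<close>\<close>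

text \<open>A repeated factor also divides the derivative \<open>k X^(k-1)\<close>, hence the
  constant \<open>k\<close>, which is \<open>X\<close> times the derivative minus
  \<open>k (X^k - 1)\<close>. In characteristic 0 this is a unit.\<close>

lemma monom_diff_one_squarefree:
  fixes p :: "rat poly"
  assumes "k > 0" "p ^ 2 dvd monom 1 k - 1"
  shows "p dvd 1"
proof -
  obtain r where r: "monom 1 k - 1 = p * p * r"
    using assms(2) by (auto simp: power2_eq_square)
  have "pderiv (monom 1 k - 1) = p * (pderiv p * r + pderiv (p * r))"
    unfolding r by (simp add: pderiv_mult algebra_simps)
  then have "p dvd pderiv (monom 1 k - 1)"
    by simp
  then have "p dvd monom 1 1 * pderiv (monom 1 k - 1)"
    by (rule dvd_mult)
  also have "monom 1 1 * pderiv (monom 1 k - 1) = monom (of_nat k :: rat) k"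
    using assms(1) by (simp add: pderiv_diff pderiv_monom mult_monom)
  finally have "p dvd monom (of_nat k :: rat) k - smult (of_nat k) (monom 1 k - 1)"
    by (rule dvd_diff) (simp_all add: r mult.assoc dvd_smult del: smult_diff_right)
  also have "monom (of_nat k) k - smult (of_nat k) (monom 1 k - 1) = [:of_nat k :: rat:]"
    by (simp add: smult_diff_right smult_monom)
  finally show ?thesis
    by (rule dvd_trans) (use assms(1) in \<open>simp add: is_unit_const_poly_iff dvd_field_iff\<close>)
qed

section \<open>Orders of \<open>1 - q ^ r\<close> and of shifted factorials at a prime\<close>

text \<open>\<open>d\<close> is the multiplicative order of \<open>X\<close> modulo
  \<open>p\<close>, so divisibility by \<open>p\<close> becomes arithmetic of exponents.\<close>

locale prime_of_order =
  fixes p :: "rat poly" and d :: nat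
  assumes prime: "prime_elem p"
    and d_pos: "d > 0"
    and dvd_iff: "\<And>k. p dvd monom 1 k - 1 \<longleftrightarrow> d dvd k"
begin

lemma not_dvd_one: "\<not> p dvd 1" and nonzero: "p \<noteq> 0"
  using prime by (auto simp: prime_elem_def)

lemma ord_ge_qvar: "ord_ge p 0 (qvar powi r)"
proof -
  have "\<not> p dvd monom 1 k" for k
  proof
    assume "p dvd monom 1 k"
    \<comment> \<open>As \<open>d * k\<close> is at least \<open>k\<close> and a multiple of
      \<open>d\<close>, the power \<open>X^(d k)\<close> would be both 0 and 1 modulo
      \<open>p\<close>.\<close>
    then have "p dvd monom 1 (d * k)"
      using d_pos by (metis dvd_mult2 mult_monom mult_1 le_add_diff_inverse mult_le_mono1 Suc_leI One_nat_def)
    moreover have "p dvd monom 1 (d * k) - 1"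
      by (simp add: dvd_iff)
    ultimately show False
      using not_dvd_one by (metis dvd_diff diff_diff_eq2 add_diff_cancel_left')
  qed
  then show ?thesis
    unfolding ord_ge_def
    by (intro exI[of _ "if r \<ge> 0 then monom 1 (nat r) else 1"]
          exI[of _ "if r \<ge> 0 then 1 else monom 1 (nat (- r))"])
       (auto simp: power_int_def qvar_power field_simps not_dvd_one)
qed

text \<open>A negative exponent is reduced to a polynomial by
  \<open>1 - q^r = q^r (q^(-r) - 1)\<close>; the factor \<open>u\<close> is a unit at
  \<open>p\<close>.\<close>

lemma one_minus_qvar_powi:
  obtains u where "ord_ge p 0 u" "ord_ge p 0 (inverse u)"
    "1 - qvar powi r = u * to_fract (monom 1 (nat \<bar>r\<bar>) - 1)"
proof (cases "r \<ge> 0")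
  case True
  show ?thesis
    using that[of "- 1"] True ord_ge_to_fract[OF not_dvd_one, of 0 "- 1"]
    by (simp add: qvar_power[symmetric] power_int_def)
next
  case False
  show ?thesis
    using that[of "qvar powi r"] False ord_ge_qvar[of r] ord_ge_qvar[of "- r"] qvar_nz
    by (simp add: qvar_power[symmetric] power_int_def field_simps)
qed

lemma ord_ge_factor: "ord_ge p (of_bool (int d dvd r)) (1 - qvar powi r)"
proof -
  obtain u where u: "ord_ge p 0 u" "1 - qvar powi r = u * to_fract (monom 1 (nat \<bar>r\<bar>) - 1)"
    by (rule one_minus_qvar_powi)
  have "p ^ of_bool (int d dvd r) dvd monom 1 (nat \<bar>r\<bar>) - 1"
    using dvd_iff[of "nat \<bar>r\<bar>"] by (auto simp: int_dvd_int_iff[symmetric])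
  then obtain x where "monom 1 (nat \<bar>r\<bar>) - 1 = p ^ of_bool (int d dvd r) * x"
    by blast
  then show ?thesis
    using ord_ge_mult[OF prime u(1) ord_ge_to_fract[OF not_dvd_one, of "of_bool (int d dvd r)" x]]
      u(2) by simp
qed

text \<open>Squarefreeness of \<open>X ^ k - 1\<close> makes the pole at most simple.\<close>

lemma ord_ge_inverse_factor:
  assumes "r \<noteq> 0"
  shows "ord_ge p (- of_bool (int d dvd r)) (inverse (1 - qvar powi r))"
proof -
  obtain u where u: "ord_ge p 0 (inverse u)"
      "1 - qvar powi r = u * to_fract (monom 1 (nat \<bar>r\<bar>) - 1)"
    by (rule one_minus_qvar_powi)
  let ?f = "monom 1 (nat \<bar>r\<bar>) - 1 :: rat poly"
  have "\<exists>x. \<not> p dvd x \<and> ?f = p ^ of_bool (int d dvd r) * x"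
  proof (cases "int d dvd r")
    case True
    then have "p dvd ?f"
      by (auto simp: dvd_iff int_dvd_int_iff[symmetric])
    then obtain x where x: "?f = p * x"
      by blast
    moreover have "\<not> p dvd x"
    proof
      assume "p dvd x"
      then have "p ^ 2 dvd ?f"
        unfolding x power2_eq_square by (rule mult_dvd_mono[OF dvd_refl])
      then show False
        using monom_diff_one_squarefree[of "nat \<bar>r\<bar>" p] assms not_dvd_one by simp
    qed
    ultimately show ?thesis
      using True by auto
  next
    case False
    then have "\<not> p dvd ?f"
      by (auto simp: dvd_iff int_dvd_int_iff[symmetric])
    then show ?thesis
      using False by auto
  qed
  then obtain x where x: "\<not> p dvd x" "?f = p ^ of_bool (int d dvd r) * x"
    by blast
  have "ord_ge p (- of_bool (int d dvd r)) (inverse (to_fract ?f))"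
    unfolding ord_ge_def x(2) using x(1)
    by (intro exI[of _ 1] exI[of _ x]) (auto simp: field_simps)
  then show ?thesis
    using ord_ge_mult[OF prime u(1)] by (fastforce simp: u(2))
qed

text \<open>Since \<open>d\<close> is coprime to \<open>l\<close>, the numerator factors divisible
  by \<open>p\<close> are those with \<open>j\<close> congruent to \<open>M\<close> modulo
  \<open>d\<close>, and the denominator has exactly \<open>K div d\<close> such factors. Each
  complete block of \<open>d\<close> indices balances; the incomplete last block gives an extra zero
  if \<open>K = M\<close> or \<open>K < d\<close>.\<close>

lemma ord_ge_qpoch_ratio:
  assumes "l \<noteq> 0" and cop: "coprime (int d) l" and dvd: "int d dvd t + l * int M" and "M \<le> K"
  shows "ord_ge p (of_bool (K = M \<or> K < d))
    (qpoch (qvar powi t) (qvar powi l) (Suc K) / qpoch (qvar powi l) (qvar powi l) K)"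
proof -
  have num_iff: "int d dvd t + l * int j \<longleftrightarrow> j mod d = M mod d" for j
  proof -
    have "t + l * int j = (t + l * int M) + (int j - int M) * l"
      by (simp add: algebra_simps)
    then have "int d dvd t + l * int j \<longleftrightarrow> int d dvd (int j - int M) * l"
      using dvd_add_right_iff[OF dvd] by (simp only:)
    also have "\<dots> \<longleftrightarrow> int d dvd int j - int M"
      using cop by (simp add: coprime_dvd_mult_left_iff)
    also have "\<dots> \<longleftrightarrow> j mod d = M mod d"
      by (simp add: mod_eq_dvd_iff[symmetric] zmod_int[symmetric])
    finally show ?thesis .
  qed
  have den_iff: "int d dvd l * int (Suc j) \<longleftrightarrow> d dvd Suc j" for j
    using cop by (simp add: coprime_dvd_mult_right_iff int_dvd_int_iff del: of_nat_Suc)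
  let ?e = "(\<Sum>j<Suc K. of_bool (int d dvd t + l * int j))
    + (\<Sum>j<K. - of_bool (int d dvd l * int (Suc j))) :: int"
  have "ord_ge p ?e ((\<Prod>j<Suc K. 1 - qvar powi (t + l * int j))
      * (\<Prod>j<K. inverse (1 - qvar powi (l * int (Suc j)))))"
    using \<open>l \<noteq> 0\<close>
    by (intro ord_ge_mult ord_ge_prod ord_ge_factor ord_ge_inverse_factor prime) auto
  moreover have "qpoch (qvar powi t) (qvar powi l) n = (\<Prod>j<n. 1 - qvar powi (t + l * int j))" for n
    by (simp add: qpoch_def power_int_add power_int_mult qvar_nz)
  moreover have "qpoch (qvar powi l) (qvar powi l) n = (\<Prod>j<n. 1 - qvar powi (l * int (Suc j)))" for n
    unfolding power_int_mult power_int_of_nat power_Suc by (simp add: qpoch_def)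
  moreover have "of_bool (K = M \<or> K < d) \<le> ?e"
  proof -
    have den: "(\<Sum>j<n. of_bool (d dvd Suc j)) = n div d" for n
      by (induction n) (simp_all add: div_Suc mod_eq_0_iff_dvd)
    have num: "(\<Sum>j<Suc K. of_bool (j mod d = M mod d)) = card {j. j \<le> K \<and> j mod d = M mod d}"
      by (simp add: lessThan_Suc_atMost Int_def flip: card_eq_sum)
    \<comment> \<open>The indices in the residue class of \<open>M\<close> are numbered by their
      block \<open>i\<close>.\<close>
    have card_ge: "card I \<le> card {j. j \<le> K \<and> j mod d = M mod d}"
      if "\<And>i. i \<in> I \<Longrightarrow> d * i + M mod d \<le> K" for I
      using that d_pos by (intro card_inj_on_le[of "\<lambda>i. d * i + M mod d"]) (auto simp: inj_on_def)
    have "K div d + of_bool (K = M \<or> K < d) \<le> card {j. j \<le> K \<and> j mod d = M mod d}"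
    proof (cases "K = M \<or> K < d")
      case True
      \<comment> \<open>The last block counts too: for \<open>K = M\<close> it ends exactly at the
        residue of \<open>M\<close>, and for \<open>K < d\<close> it is the only block and contains
        \<open>M\<close>.\<close>
      have "d * i + M mod d \<le> K" if "i \<in> {..K div d}" for i
      proof (cases "K = M")
        case True
        have "d * i \<le> d * (M div d)"
          using that True by simp
        then have "d * i + M mod d \<le> d * (M div d) + M mod d"
          by (rule add_right_mono)
        then show ?thesis
          using True by simp
      next
        case False
        then show ?thesis
          using \<open>K = M \<or> K < d\<close> that \<open>M \<le> K\<close> by simp
      qed
      from card_ge[of "{..K div d}", OF this] show ?thesis
        using True by simp
    next
      case False
      have "d * i + M mod d \<le> K" if "i \<in> {..<K div d}" for i
      proof -
        have "d * Suc i \<le> d * (K div d)"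
          using that by (intro mult_le_mono2) simp
        also have "\<dots> \<le> K"
          by simp
        finally show ?thesis
          using mod_less_divisor[OF d_pos, of M] by simp
      qed
      from card_ge[of "{..<K div d}", OF this] show ?thesis
        using False by simp
    qed
    then have "int (\<Sum>j<K. of_bool (d dvd Suc j)) + of_bool (K = M \<or> K < d)
        \<le> int (\<Sum>j<Suc K. of_bool (j mod d = M mod d))"
      unfolding den num by (metis of_nat_add of_nat_le_iff of_nat_of_bool)
    then show ?thesis
      unfolding num_iff den_iff sum_negf of_nat_sum of_nat_of_bool by linarith
  qed
  ultimately show ?thesis
    using prod_inversef[of "\<lambda>j. 1 - qvar powi (l * int (Suc j))" "{..<K}"]
    unfolding divide_inverse o_def by (simp only: ord_ge_mono[OF nonzero])
qed

end

lemma prime_of_order_exists: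
  assumes p: "prime_elem p" and m: "m > 0" "p dvd monom 1 m - 1"
  obtains d where "prime_of_order p d" "d dvd m"
proof -
  define d where "d = (LEAST k. k > 0 \<and> p dvd monom 1 k - 1)"
  have d: "d > 0 \<and> p dvd monom 1 d - 1"
    unfolding d_def by (rule LeastI[of _ m]) (use m in auto)
  have least: "d \<le> k" if "k > 0" "p dvd monom 1 k - 1" for k
    unfolding d_def by (rule Least_le) (use that in auto)
  \<comment> \<open>This identity gives both the induction over multiples of \<open>d\<close> and
    the reduction of \<open>k\<close> to \<open>k mod d\<close>.\<close>
  have shift: "monom 1 (i + j) - 1 = monom 1 i * (monom 1 j - 1) + (monom 1 i - 1 :: rat poly)" for i j
    by (simp add: mult_monom algebra_simps)
  have mult: "p dvd monom 1 (d * i) - 1" for i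
  proof (induction i)
    case (Suc i)
    then show ?case
      using d by (simp add: shift)
  qed simp
  have "p dvd monom 1 k - 1 \<longleftrightarrow> d dvd k" for k
  proof
    assume k: "p dvd monom 1 k - 1"
    have "p dvd monom 1 (k mod d + d * (k div d)) - 1"
      using k by simp
    then have "p dvd monom 1 (k mod d) - 1"
      unfolding shift using mult by (simp add: dvd_add_right_iff)
    then have "k mod d = 0"
      using least[of "k mod d"] mod_less_divisor[of d k] d by fastforce
    then show "d dvd k"
      by auto
  qed (use mult in auto)
  with p d have "prime_of_order p d"
    by unfold_locales auto
  with m show ?thesis
    using that prime_of_order.dvd_iff by blast
qed

section \<open>\<open>[m]\<close> and its cyclotomic factor\<close>

lemma qint_poly_factor: "qint_poly m * (monom 1 1 - 1) = monom 1 m - 1"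
proof -
  have "to_fract (qint_poly m * (monom 1 1 - 1)) = qint (int m) * (qvar - 1)"
    by (simp add: to_fract_qint_poly flip: qvar_power)
  also have "\<dots> = to_fract (monom 1 m - 1)"
    using qvar_neq_1 by (simp add: qint_def qvar_power[symmetric] field_simps)
  finally show ?thesis
    by (simp only: to_fract_eq_iff)
qed

lemma monom_diff_one_nonzero:
  assumes "m > 0"
  shows "monom 1 m - 1 \<noteq> (0 :: rat poly)"
proof
  assume "monom 1 m - 1 = (0 :: rat poly)"
  then have "coeff (monom 1 m - 1 :: rat poly) m = 0"
    by simp
  then show False
    using assms by simp
qed

lemma qint_poly_nonzero: "m > 0 \<Longrightarrow> qint_poly m \<noteq> 0"
  using qint_poly_factor[of m] monom_diff_one_nonzero[of m] by auto

text \<open>For \<open>m > 1\<close> the factors \<open>cyclotomic 1 = X - 1\<close> and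
  \<open>cyclotomic m\<close> of \<open>X ^ m - 1\<close> have different indices, so
  \<open>X - 1\<close> can be cancelled.\<close>

lemma cyclotomic_dvd_qint_poly:
  assumes "m > 1"
  shows "cyclotomic m dvd qint_poly m"
proof -
  have one: "cyclotomic 1 = monom 1 1 - 1"
    using prod_cyclotomic[of 1] by simp
  have "(\<Prod>d\<in>{1, m}. cyclotomic d) dvd (\<Prod>d | d dvd m. cyclotomic d)"
    using assms by (intro prod_dvd_prod_subset) auto
  then have "cyclotomic m * cyclotomic 1 dvd monom 1 m - 1"
    using assms by (simp add: prod_cyclotomic mult.commute)
  then have "cyclotomic m * (monom 1 1 - 1) dvd qint_poly m * (monom 1 1 - 1)"
    by (simp only: one qint_poly_factor)
  then show ?thesis
    using monom_diff_one_nonzero[of 1] by (simp only: dvd_mult_cancel_right) simp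
qed

text \<open>Since \<open>X ^ m - 1\<close> is squarefree and \<open>cyclotomic d\<close> divides \<open>X ^ d - 1\<close>, a prime factor
  of \<open>cyclotomic m\<close> cannot divide \<open>X ^ d - 1\<close> for a proper divisor \<open>d\<close> of \<open>m\<close>.\<close>

lemma (in prime_of_order) order_eq_if_dvd_cyclotomic:
  assumes "m > 0" "d dvd m" "p dvd cyclotomic m"
  shows "d = m"
proof (rule ccontr)
  assume "d \<noteq> m"
  have fin: "finite {e. e dvd m}"
    using assms(1) by simp
  have "{e. e dvd d} \<subseteq> {e. e dvd m} - {m}"
    using assms(1,2) \<open>d \<noteq> m\<close> by (auto dest: dvd_antisym intro: dvd_trans)
  then have "(\<Prod>e | e dvd d. cyclotomic e) dvd (\<Prod>e \<in> {e. e dvd m} - {m}. cyclotomic e)"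
    using fin by (intro prod_dvd_prod_subset) auto
  then have "p dvd (\<Prod>e \<in> {e. e dvd m} - {m}. cyclotomic e)"
    using dvd_iff[of d] unfolding prod_cyclotomic[OF d_pos] by (meson dvd_refl dvd_trans)
  then have "p ^ 2 dvd cyclotomic m * (\<Prod>e \<in> {e. e dvd m} - {m}. cyclotomic e)"
    unfolding power2_eq_square using assms(3) by (rule mult_dvd_mono[rotated])
  also have "\<dots> = monom 1 m - 1"
    using prod.remove[OF fin, of m cyclotomic] prod_cyclotomic[OF assms(1)] by simp
  finally show False
    using monom_diff_one_squarefree[OF assms(1)] not_dvd_one by blast
qed

subsection \<open>The congruence\<close>

text \<open>The telescoping lemma for \<open>a = q^t\<close> and base \<open>q^l\<close>. Each of
  the two terms in braces supplies two q-integers and the common prefix a third, whence the cube of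
  \<open>inverse (1 - qvar)\<close>.\<close>

lemma truncated_sum_closed_form:
  fixes t l :: int and s N :: nat
  assumes "l > 0" "s \<le> N"
  defines "R \<equiv> \<lambda>K. qpoch (qvar powi t) (qvar powi l) (Suc K) / qpoch (qvar powi l) (qvar powi l) K"
  shows "(\<Sum>n=s..N.
       (-1) ^ n * qint (2 * l * int n + t)
       * ((qpoch (qvar powi t) (qvar powi l) (n + s)
           * qpoch (qvar powi t) (qvar powi l) (n - s)
           * qpoch (qvar powi t) (qvar powi l) n)
          / (qpoch (qvar powi l) (qvar powi l) (n + s)
             * qpoch (qvar powi l) (qvar powi l) (n - s)
             * qpoch (qvar powi l) (qvar powi l) n))
       * (qvar powi (l * int n * (int n + 1) div 2 - int n * t)
            * qint (t + l * int s) * qint (t - l * int s)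
          + qvar powi (l * int n * (int n - 1) div 2 - (int n - 1) * t)
            * qint (l * int n) * qint (t + l * int n)))
    = (-1) ^ N * qvar powi (l * int N * (int N + 1) div 2 - int N * t) * inverse (1 - qvar) ^ 3
      * (R (N + s) * R (N - s) * R N)"
    (is "sum ?f _ = _")
proof -
  define a p :: "rat poly fract" where "a = qvar powi t" and "p = qvar powi l"
  define c where "c = inverse (1 - qvar)"
  define w where "w n = (-1) ^ n * qvar powi (l * int n * (int n + 1) div 2 - int n * t)" for n
  have nz: "a \<noteq> 0" "p \<noteq> 0"
    using qvar_nz by (simp_all add: a_def p_def)
  have p: "qvar powi (l * int k) = p ^ k" for k
    by (simp add: p_def power_int_mult)
  have "p ^ k \<noteq> 1" if "k > 0" for k
  proof
    assume "p ^ k = 1"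
    then have "to_fract (monom 1 (nat l * k)) = (to_fract 1 :: rat poly fract)"
      using \<open>l > 0\<close> unfolding qvar_power[symmetric] by (simp add: p_def power_int_def power_mult)
    then have "degree (monom 1 (nat l * k) :: rat poly) = degree (1 :: rat poly)"
      by (simp only: to_fract_eq_iff)
    then show False
      using that \<open>l > 0\<close> by (simp add: degree_monom_eq)
  qed
  moreover have "w (Suc n) * a = - w n * p ^ Suc n" for n
  proof -
    \<comment> \<open>The difference is visibly twice an integer, so \<open>div 2\<close> passes
      through without a parity argument.\<close>
    have "l * int (Suc n) * (int (Suc n) + 1) = l * int n * (int n + 1) + (l * int (Suc n)) * 2"
      by (simp add: algebra_simps)
    then have "l * int (Suc n) * (int (Suc n) + 1) div 2 - int (Suc n) * t + t
        = (l * int n * (int n + 1) div 2 - int n * t) + l * int (Suc n)"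
      by (simp add: algebra_simps)
    then show ?thesis
      unfolding w_def a_def p[symmetric]
      by (simp add: mult.assoc flip: power_int_add[OF disjI1[OF qvar_nz]] del: of_nat_Suc)
  qed
  ultimately have sum: "(\<Sum>n=s..N. w n * (1 - a * p ^ (2 * n))
      * ((qpoch a p (n + s) * qpoch a p (n - s) * qpoch a p n)
         / (qpoch p p (n + s) * qpoch p p (n - s) * qpoch p p n))
      * ((1 - a * p ^ s) * (1 - a / p ^ s) + a / p ^ n * (1 - p ^ n) * (1 - a * p ^ n)))
    = w N * R (N + s) * R (N - s) * R N"
    unfolding R_def a_def[symmetric] p_def[symmetric]
    by (intro well_poised_sum_telescopes nz \<open>s \<le> N\<close>) auto
  have "?f n = c ^ 3 * (w n * (1 - a * p ^ (2 * n))
      * ((qpoch a p (n + s) * qpoch a p (n - s) * qpoch a p n)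
         / (qpoch p p (n + s) * qpoch p p (n - s) * qpoch p p n))
      * ((1 - a * p ^ s) * (1 - a / p ^ s) + a / p ^ n * (1 - p ^ n) * (1 - a * p ^ n)))" for n
  proof -
    have "l * int n * (int n + 1) = l * int n * (int n - 1) + (l * int n) * 2"
      by (simp add: algebra_simps)
    then have "l * int n * (int n - 1) div 2 - (int n - 1) * t
        = (l * int n * (int n + 1) div 2 - int n * t) + t - l * int n"
      by (simp add: algebra_simps)
    \<comment> \<open>The second power of \<open>q\<close> is the first times
      \<open>a / p ^ n\<close>, the weight that the telescoping lemma requires.\<close>
    then have exponent: "qvar powi (l * int n * (int n - 1) div 2 - (int n - 1) * t)
        = qvar powi (l * int n * (int n + 1) div 2 - int n * t) * (a / p ^ n)"
      by (simp add: power_int_add power_int_diff qvar_nz a_def p)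
    have qint: "qint r = c * (1 - qvar powi r)" for r
      by (simp add: qint_def c_def field_simps)
    have "qvar powi (2 * l * int n + t) = a * p ^ (2 * n)"
        "qvar powi (t + l * int k) = a * p ^ k" "qvar powi (t - l * int k) = a / p ^ k" for k
      using p[of "2 * n"] by (simp_all add: power_int_add power_int_diff qvar_nz a_def p mult_ac)
    note powi = this p
    show ?thesis
      unfolding exponent qint powi a_def[symmetric] p_def[symmetric] w_def power3_eq_cube
      by (simp only: distrib_left distrib_right mult_ac)
  qed
  then have "sum ?f {s..N} = c ^ 3 * (w N * R (N + s) * R (N - s) * R N)"
    unfolding sum[symmetric] sum_distrib_left by simp
  then show ?thesis
    by (simp add: w_def c_def mult_ac)
qed

theorem theorem1p3:
  fixes t l :: int and m s :: nat
  assumes "l \<ge> 2"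
    and "m > 0"
    and "[int m = - t] (mod l)"
    and "gcd (int m) l = 1"
    and "int m > 2 * l * int s - t"
    and nondegenerate: "\<not> (m = 1 \<and> s = 0 \<and> t = l - 1)"
  shows "ratfun_cong_0
    (\<Sum>n | s \<le> n \<and> int n \<le> ((l - 1) * int m - t) div l + int s.
       (-1) ^ n * qint (2 * l * int n + t)
       * ((qpoch (qvar powi t) (qvar powi l) (n + s)
           * qpoch (qvar powi t) (qvar powi l) (n - s)
           * qpoch (qvar powi t) (qvar powi l) n)
          / (qpoch (qvar powi l) (qvar powi l) (n + s)
             * qpoch (qvar powi l) (qvar powi l) (n - s)
             * qpoch (qvar powi l) (qvar powi l) n))
       * (qvar powi (l * int n * (int n + 1) div 2 - int n * t)
            * qint (t + l * int s) * qint (t - l * int s)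
          + qvar powi (l * int n * (int n - 1) div 2 - (int n - 1) * t)
            * qint (l * int n) * qint (t + l * int n)))
    (qint_poly m * cyclotomic m ^ 2)"
    (is "ratfun_cong_0 ?S ?P")
proof (cases "(l - 1) * int m - t < 0")
  case True
  then have "((l - 1) * int m - t) div l < 0"
    using \<open>l \<ge> 2\<close> by (simp add: pos_imp_zdiv_neg_iff)
  then have "{n. s \<le> n \<and> int n \<le> ((l - 1) * int m - t) div l + int s} = {}"
    by auto
  then have "?S = 0"
    by (simp only: sum.empty)
  then show ?thesis
    unfolding ratfun_cong_0_def by (intro exI[of _ 0] exI[of _ 1]) simp
next
  case False
  define M where "M = nat (((l - 1) * int m - t) div l)"
  define N where "N = M + s"
  define R where
    "R K = qpoch (qvar powi t) (qvar powi l) (Suc K) / qpoch (qvar powi l) (qvar powi l) K" for K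
  have M: "int M = ((l - 1) * int m - t) div l"
    using False \<open>l \<ge> 2\<close> by (simp add: M_def pos_imp_zdiv_nonneg_iff)
  have "l dvd int m + t"
    using assms(3) by (simp add: cong_iff_dvd_diff)
  then have "l dvd l * int m - (int m + t)"
    by simp
  then have "l dvd (l - 1) * int m - t"
    by (simp add: algebra_simps)
  \<comment> \<open>The division is exact: the last factor of the numerator of \<open>R M\<close> is
    \<open>1 - q^((l-1) m)\<close>.\<close>
  then have tM: "t + l * int M = (l - 1) * int m"
    using M by simp
  have "l * int (M + 2 * s) < l * int m"
    using assms(5) tM by (simp add: algebra_simps)
  \<comment> \<open>The lower bound on \<open>m\<close> in this form says that the largest index
    \<open>N + s\<close> is below \<open>m\<close>.\<close>
  then have less: "M + 2 * s < m"
    using \<open>l \<ge> 2\<close> by simp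
  \<comment> \<open>For \<open>m = 1\<close> the bound forces \<open>M = s = 0\<close>, hence
    \<open>t = l - 1\<close>. In this excluded case the sum is \<open>[l-1]^3\<close>, which does
    not vanish at \<open>q = 1\<close>.\<close>
  have "m \<noteq> 1"
    using less tM nondegenerate by auto
  then have "m > 1"
    using \<open>m > 0\<close> by simp
  have "{n. s \<le> n \<and> int n \<le> ((l - 1) * int m - t) div l + int s} = {s..N}"
    by (auto simp: N_def simp flip: M)
  then have S: "?S = (-1) ^ N * qvar powi (l * int N * (int N + 1) div 2 - int N * t)
      * inverse (1 - qvar) ^ 3 * (R (N + s) * R (N - s) * R N)"
    using truncated_sum_closed_form[of l s N t] \<open>l \<ge> 2\<close> unfolding R_def by (simp add: N_def)
  have qint_poly_nz: "qint_poly m \<noteq> 0"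
    using qint_poly_nonzero \<open>m > 0\<close> .
  have cyclotomic_dvd: "cyclotomic m dvd qint_poly m"
    using cyclotomic_dvd_qint_poly \<open>m > 1\<close> .
  then have cyclotomic_nz: "cyclotomic m \<noteq> 0"
    using qint_poly_nz by auto
  show ?thesis
  proof (rule ratfun_cong_0I)
    show "?P \<noteq> 0"
      using qint_poly_nz cyclotomic_nz by simp
    fix p :: "rat poly"
    assume p: "prime_elem p" and "p dvd ?P"
    have p_dvd: "p dvd qint_poly m"
      using p \<open>p dvd ?P\<close> cyclotomic_dvd by (meson dvd_trans prime_elem_dvd_mult_iff prime_elem_dvd_power)
    then have "p dvd monom 1 m - 1"
      using qint_poly_factor[of m] by (metis dvd_mult2)
    then obtain d where "prime_of_order p d" "d dvd m"
      using prime_of_order_exists[OF p \<open>m > 0\<close>] by blast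
    interpret prime_of_order p d by fact
    have "\<not> p ^ 2 dvd monom 1 m - 1"
      using monom_diff_one_squarefree \<open>m > 0\<close> not_dvd_one by blast
    then have "\<not> p ^ 2 dvd qint_poly m"
      using qint_poly_factor[of m] by (metis dvd_mult2)
    then have "multiplicity p (qint_poly m) < 2"
      using qint_poly_nz not_dvd_one by (intro multiplicity_lessI)
    moreover have "multiplicity p (cyclotomic m) \<le> multiplicity p (qint_poly m)"
      using cyclotomic_dvd qint_poly_nz by (intro dvd_imp_multiplicity_le)
    moreover have "multiplicity p (cyclotomic m) = 0" if "d \<noteq> m"
      using that order_eq_if_dvd_cyclotomic \<open>m > 0\<close> \<open>d dvd m\<close> not_dvd_imp_multiplicity_0 by blast
    \<comment> \<open>\<open>[m]\<close> contributes at most 1, and the squared cyclotomic factor at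
      most 2, the latter only for \<open>d = m\<close>.\<close>
    ultimately have mult: "multiplicity p ?P \<le> 1 + 2 * of_bool (d = m)"
      using qint_poly_nz cyclotomic_nz p
      by (auto simp: prime_elem_multiplicity_mult_distrib prime_elem_multiplicity_power_distrib)
    \<comment> \<open>\<open>[m] (X - 1) = X^m - 1\<close> is squarefree, so \<open>p\<close> does
      not divide \<open>X - 1\<close> and the prefactor \<open>(1 - q)^(-3)\<close> has no pole at
      \<open>p\<close>.\<close>
    have "d \<noteq> 1"
    proof
      assume "d = 1"
      then have "p dvd monom 1 1 - 1"
        by (simp add: dvd_iff)
      with p_dvd have "p ^ 2 dvd qint_poly m * (monom 1 1 - 1)"
        unfolding power2_eq_square by (rule mult_dvd_mono)
      then have "p ^ 2 dvd monom 1 m - 1"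
        by (simp only: qint_poly_factor)
      then show False
        using \<open>\<not> p ^ 2 dvd monom 1 m - 1\<close> by blast
    qed
    have "coprime (int m) l"
      using assms(4) by (simp add: coprime_iff_gcd_eq_1)
    then have cop: "coprime (int d) l"
      using \<open>d dvd m\<close> by (meson coprime_divisors dvd_refl int_dvd_int_iff)
    have "int d dvd t + l * int M"
      using \<open>d dvd m\<close> unfolding tM by simp
    note ratio = ord_ge_qpoch_ratio[OF _ cop this, folded R_def]
    \<comment> \<open>The summand 1 comes from \<open>R M\<close>, where \<open>K = M\<close>. For
      \<open>d = m\<close> the other two indices are below \<open>d\<close>, so the total is
      3.\<close>
    have "ord_ge p (of_bool (M + 2 * s = M \<or> M + 2 * s < d) + 1 + of_bool (N = M \<or> N < d))
        (R (N + s) * R (N - s) * R N)"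
      using ratio[of "M + 2 * s"] ratio[of M] ratio[of N] \<open>l \<ge> 2\<close>
      by (intro ord_ge_mult prime) (simp_all add: N_def mult_2 add.assoc)
    then have "ord_ge p (int (multiplicity p ?P)) (R (N + s) * R (N - s) * R N)"
      by (rule ord_ge_mono[OF nonzero]) (use mult less in \<open>cases "d = m"; auto simp: N_def\<close>)
    moreover have "ord_ge p 0 ((- 1) ^ N)"
      using ord_ge_to_fract[OF not_dvd_one, of 0 "- 1"]
      by (intro ord_ge_power_0 prime) simp
    moreover have "ord_ge p 0 (inverse (1 - qvar) ^ 3)"
      using ord_ge_inverse_factor[of 1] \<open>d \<noteq> 1\<close> by (intro ord_ge_power_0 prime) simp
    ultimately show "ord_ge p (int (multiplicity p ?P)) ?S"
      unfolding S
      using ord_ge_mult[OF prime ord_ge_mult[OF prime ord_ge_mult[OF prime _ ord_ge_qvar]]]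
      by fastforce
  qed
qed

end
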